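(* Let $1\le k\le n$, $\alpha\ge 0$, and let $Q_S^k=\sigma_k+\alpha\sigma_{k-1}$. Then $Q_S^k$ satisfies the following quotient concavity condition on the cone $$\tilde\Gamma_k=\Gamma_{k-1}\cap\{\lambda\in\mathbb{R}^n:\ \alpha\sigma_{k-1}(\lambda)+\sigma_k(\lambda)>0\}:$$ there are $k-1$ polynomials $S_1,\dots,S_{k-1}$ of the form $S_l=\sigma_l+\sum_{s=0}^{l-1}\beta^l_s\sigma_s$, with constants $\beta^l_s\ge 0$, such that $(Q_S^k/S_l)^{1/(k-l)}$ is a concave function on $\tilde\Gamma_k$ for every $1\le l\le k-1$.
   Context: $\sigma_m$ denotes the $m$-th elementary symmetric polynomial in $n$ variables, $\sigma_0=1$. $\Gamma_k=\{\lambda\in\mathbb{R}^n:\sigma_m(\lambda)>0,\ m=1,\dots,k\}$ is the Garding cone ($\Gamma_0=\mathbb{R}^n$). The equation $Q_S^k(\kappa)=f$ is called the sum type equation and $\tilde\Gamma_k$ its admissible set. *)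

theory Defs
  imports "HOL-Analysis.Analysis"
begin

definition elem_sym :: "nat \<Rightarrow> real ^ 'n \<Rightarrow> real" where
  "elem_sym m x = (\<Sum>A | card A = m. \<Prod>i\<in>A. x $ i)"

definition Garding_cone :: "nat \<Rightarrow> (real ^ 'n) set" where
  "Garding_cone k = {x. \<forall>m\<in>{1..k}. elem_sym m x > 0}"

text \<open>The index \<open>k - 1\<close> is natural-number subtraction; the next two definitions are only meant
  for \<open>k \<ge> 1\<close>.\<close>

definition sum_type :: "nat \<Rightarrow> real \<Rightarrow> real ^ 'n \<Rightarrow> real" where
  "sum_type k \<alpha> x = elem_sym k x + \<alpha> * elem_sym (k - 1) x"

definition sum_type_cone :: "nat \<Rightarrow> real \<Rightarrow> (real ^ 'n) set" where
  "sum_type_cone k \<alpha> =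
     Garding_cone (k - 1) \<inter> {x. \<alpha> * elem_sym (k - 1) x + elem_sym k x > 0}"

lemma elem_sym_0: "elem_sym 0 x = 1"
  by (simp add: elem_sym_def)

lemma Garding_cone_0: "Garding_cone 0 = UNIV"
  by (simp add: Garding_cone_def)

end

theory Submission
  imports Defs
begin

text \<open>
  The parameter \<open>\<alpha>\<close> is an additional variable: since
  \<open>\<sigma>\<^sub>k(\<lambda>) + \<alpha> \<sigma>\<^sub>k\<^sub>-\<^sub>1(\<lambda>) = \<sigma>\<^sub>k(\<lambda>, \<alpha>)\<close>, the sum type operator in \<open>n\<close> variables is the
  elementary symmetric polynomial in \<open>n + 1\<close> variables with the last one held fixed at \<open>\<alpha>\<close>, and
  its admissible set is the corresponding affine slice of the Garding cone of \<open>n + 1\<close> variables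
  (\<open>sum_type_cone_eq_slice\<close>).  The polynomials
  \<open>S\<^sub>l(\<lambda>) = \<sigma>\<^sub>l(\<lambda>, \<alpha>) = \<sigma>\<^sub>l(\<lambda>) + \<alpha> \<sigma>\<^sub>l\<^sub>-\<^sub>1(\<lambda>)\<close> then reduce the claim to the classical
  concavity of \<open>(\<sigma>\<^sub>k / \<sigma>\<^sub>l)\<^bsup>1/(k-l)\<^esup>\<close> on a Garding cone, because concavity
  passes to affine slices.

  The classical fact is proved in the following way.  The function in question is the geometric
  mean of the ratios \<open>h\<^sub>j = \<sigma>\<^sub>j\<^sub>+\<^sub>1 / \<sigma>\<^sub>j\<close> for \<open>l \<le> j < k\<close>.  Everything is homogeneous of degree
  one, so concavity means superadditivity, and geometric means are monotone and superadditive by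
  the arithmetic-geometric inequality; hence it is enough that each \<open>h\<^sub>j\<close> is superadditive
  (\<open>esym_cone_add_and_ratio_superadditive\<close>).  This goes by induction on \<open>j\<close>, following Marcus and
  Lopes: Euler's relation exhibits \<open>(j + 2) h\<^sub>j\<^sub>+\<^sub>1\<close> as a sum over the variables \<open>x\<^sub>i\<close> of the parallel
  sums \<open>a b / (a + b)\<close> of \<open>a = x\<^sub>i\<close> and \<open>b = h\<^sub>j\<close> evaluated at the remaining variables, and the
  parallel sum is monotone and superadditive on the half plane \<open>a + b > 0\<close>.  Convexity of the
  cone comes out of the same induction.

  To stay in that half plane, deleting a variable must lead from the cone of order \<open>m + 1\<close> to
  the cone of order \<open>m\<close> (\<open>esym_cone_remove\<close>).  As the variables may be negative, this rests on
  Newton's inequality \<open>\<sigma>\<^sub>m \<sigma>\<^sub>m\<^sub>+\<^sub>2 \<le> \<sigma>\<^sub>m\<^sub>+\<^sub>1\<^sup>2\<close> for arbitrary real variables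
  (\<open>esym_Newton\<close>), which has an elementary proof by induction from a sum-of-squares identity.
\<close>

section \<open>Elementary symmetric polynomials over finite index sets\<close>

text \<open>
  The index set is an argument because the inductions below delete variables.
\<close>

definition esym :: "'i set \<Rightarrow> nat \<Rightarrow> ('i \<Rightarrow> real) \<Rightarrow> real" where
  "esym A m x = (\<Sum>B | B \<subseteq> A \<and> card B = m. \<Prod>i\<in>B. x i)"

lemma esym_0: "finite A \<Longrightarrow> esym A 0 x = 1"
proof -
  assume "finite A"
  then have "{B. B \<subseteq> A \<and> card B = 0} = {{}}"
    by (auto dest: finite_subset)
  then show ?thesis by (simp add: esym_def)
qed

lemma esym_insert:
  assumes "finite A" "i \<notin> A"
  shows "esym (insert i A) (Suc m) x = esym A (Suc m) x + x i * esym A m x"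
proof -
  let ?S = "\<lambda>A m. {B. B \<subseteq> A \<and> card B = m}"
  have fin: "finite (?S A m)" for m using assms(1) by simp
  have split: "?S (insert i A) (Suc m) = ?S A (Suc m) \<union> insert i ` ?S A m"
  proof (intro set_eqI iffI)
    fix B assume B: "B \<in> ?S (insert i A) (Suc m)"
    show "B \<in> ?S A (Suc m) \<union> insert i ` ?S A m"
    proof (cases "i \<in> B")
      case True
      then have "B = insert i (B - {i})" "B - {i} \<in> ?S A m"
        using B by auto
      then show ?thesis by blast
    next
      case False
      then show ?thesis using B by auto
    qed
  next
    fix B assume "B \<in> ?S A (Suc m) \<union> insert i ` ?S A m"
    moreover have "card (insert i C) = Suc (card C)" if "C \<subseteq> A" for C
      using that assms by (meson card_insert_disjoint finite_subset subsetD)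
    ultimately show "B \<in> ?S (insert i A) (Suc m)" by auto
  qed
  have disj: "?S A (Suc m) \<inter> insert i ` ?S A m = {}" using assms(2) by auto
  have inj: "inj_on (insert i) (?S A m)"
    using assms(2) by (auto simp: inj_on_def) 
  have "(\<Sum>B\<in>insert i ` ?S A m. \<Prod>j\<in>B. x j) = (\<Sum>B\<in>?S A m. \<Prod>j\<in>insert i B. x j)"
    by (subst sum.reindex[OF inj]) simp
  also have "\<dots> = (\<Sum>B\<in>?S A m. x i * (\<Prod>j\<in>B. x j))"
    using assms by (intro sum.cong refl prod.insert) (auto dest: finite_subset)
  finally have "(\<Sum>B\<in>insert i ` ?S A m. \<Prod>j\<in>B. x j) = x i * esym A m x"
    by (simp add: esym_def sum_distrib_left)
  then show ?thesis
    unfolding esym_def split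
    by (subst sum.union_disjoint) (use fin disj in auto)
qed

lemma esym_remove:
  assumes "finite A" "i \<in> A"
  shows "esym A (Suc m) x = esym (A - {i}) (Suc m) x + x i * esym (A - {i}) m x"
  using esym_insert[of "A - {i}" i m x] assms by (simp add: insert_absorb)

lemma esym_empty_Suc: "esym {} (Suc m) x = 0"
proof -
  have "{B. B \<subseteq> {} \<and> card B = Suc m} = {}" by auto
  then show ?thesis unfolding esym_def by (metis sum.empty)
qed

text \<open>
  Each monomial of degree \<open>m + 1\<close> arises once from each of its \<open>m + 1\<close> variables.
\<close>

lemma esym_Euler:
  assumes "finite A"
  shows "(\<Sum>i\<in>A. x i * esym (A - {i}) m x) = real (Suc m) * esym A (Suc m) x"
  using assms
proof (induction A arbitrary: m rule: finite_induct)
  case empty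
  then show ?case by (simp add: esym_empty_Suc)
next
  case (insert a A)
  have rm: "insert a A - {i} = insert a (A - {i})" if "i \<in> A" for i
    using that insert.hyps by auto
  have *: "insert a A - {a} = A" using insert.hyps by auto
  show ?case
  proof (cases m)
    case 0
    then show ?thesis
      using insert.IH[of 0] insert.hyps
      by (simp add: esym_0 esym_insert)
  next
    case (Suc k)
    have "(\<Sum>i\<in>A. x i * esym (insert a A - {i}) m x)
        = (\<Sum>i\<in>A. x i * esym (A - {i}) (Suc k) x + x a * (x i * esym (A - {i}) k x))"
      using insert.hyps Suc
      by (intro sum.cong refl) (simp add: rm esym_insert algebra_simps)
    also have "\<dots> = real (Suc (Suc k)) * esym A (Suc (Suc k)) x
        + x a * (real (Suc k) * esym A (Suc k) x)"
      by (simp only: sum.distrib sum_distrib_left[symmetric] insert.IH)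
    finally show ?thesis
      using insert.hyps Suc * by (simp add: esym_insert algebra_simps)
  qed
qed

section \<open>Newton's inequality for real variables\<close>

text \<open>
  Write \<open>D\<^sub>j = \<sigma>\<^sub>j\<^sup>2 - \<sigma>\<^sub>j\<^sub>-\<^sub>1 \<sigma>\<^sub>j\<^sub>+\<^sub>1\<close>, and \<open>D\<^sub>j(x|i)\<close> for the same expression without the variable
  \<open>x\<^sub>i\<close>.  Then
  \<open>(j + 1) D\<^sub>j = \<sigma>\<^sub>j\<^sup>2 + (\<Sum>i. x\<^sub>i\<^sup>2 D\<^sub>j\<^sub>-\<^sub>1(x|i))\<close>,
  so \<open>D\<^sub>j \<ge> 0\<close> follows by induction on \<open>j\<close>, whatever the signs of the variables.  For the
  identity, substitute \<open>x\<^sub>i \<sigma>\<^sub>j\<^sub>-\<^sub>1(x|i) = \<sigma>\<^sub>j - \<sigma>\<^sub>j(x|i)\<close> and its analogue one degree lower into one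
  factor of each product in \<open>D\<^sub>j\<^sub>-\<^sub>1(x|i)\<close>: the terms
  \<open>x\<^sub>i \<sigma>\<^sub>j\<^sub>-\<^sub>1(x|i) \<sigma>\<^sub>j(x|i)\<close> cancel and Euler's relation evaluates the sum.
\<close>

lemma esym_Newton:
  assumes "finite A"
  shows "esym A m x * esym A (Suc (Suc m)) x \<le> (esym A (Suc m) x)\<^sup>2"
  using assms
proof (induction m arbitrary: A)
  case (0 A)
  \<comment> \<open>This is the identity for \<open>j = 1\<close>, with \<open>D\<^sub>0 = 1\<close>.\<close>
  have "(\<Sum>i\<in>A. (x i)\<^sup>2) = (\<Sum>i\<in>A. x i * esym A (Suc 0) x - x i * esym (A - {i}) (Suc 0) x)"
    using 0 by (intro sum.cong refl) (simp add: esym_remove esym_0 power2_eq_square algebra_simps)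
  also have "\<dots> = (esym A (Suc 0) x)\<^sup>2 - 2 * esym A (Suc (Suc 0)) x"
    using esym_Euler[OF 0, of x 0] esym_Euler[OF 0, of x "Suc 0"] 0
    by (simp add: sum_subtractf esym_0 power2_eq_square flip: sum_distrib_right)
  finally have "2 * esym A (Suc (Suc 0)) x \<le> (esym A (Suc 0) x)\<^sup>2"
    using sum_nonneg[of A "\<lambda>i. (x i)\<^sup>2"] by simp
  then have "esym A (Suc (Suc 0)) x \<le> (esym A (Suc 0) x)\<^sup>2"
    using zero_le_power2[of "esym A (Suc 0) x"] by linarith
  then show ?case using 0 by (simp add: esym_0)
next
  case (Suc m A)
  let ?e = "\<lambda>j. esym A j x" and ?d = "\<lambda>i j. esym (A - {i}) j x"
  let ?D = "\<lambda>i. (?d i (Suc m))\<^sup>2 - ?d i m * ?d i (Suc (Suc m))"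
  let ?j = "Suc (Suc m)"
  have "(x i)\<^sup>2 * ?D i = x i * ?d i (Suc m) * ?e ?j - x i * ?d i ?j * ?e (Suc m)" if "i \<in> A" for i
    unfolding esym_remove[OF Suc.prems that]
    by (simp add: power2_eq_square algebra_simps)
  then have "(\<Sum>i\<in>A. (x i)\<^sup>2 * ?D i)
      = (\<Sum>i\<in>A. x i * ?d i (Suc m)) * ?e ?j - (\<Sum>i\<in>A. x i * ?d i ?j) * ?e (Suc m)"
    by (simp add: sum_subtractf sum_distrib_right)
  also have "\<dots> = real ?j * (?e ?j)\<^sup>2 - real (Suc ?j) * ?e (Suc m) * ?e (Suc ?j)"
    by (simp only: esym_Euler[OF Suc.prems] power2_eq_square mult_ac)
  finally have "real (Suc ?j) * ((?e ?j)\<^sup>2 - ?e (Suc m) * ?e (Suc ?j))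
      = (?e ?j)\<^sup>2 + (\<Sum>i\<in>A. (x i)\<^sup>2 * ?D i)"
    by (simp add: algebra_simps)
  also have "\<dots> \<ge> 0"
    using Suc by (intro add_nonneg_nonneg sum_nonneg mult_nonneg_nonneg) auto
  finally show ?case by (simp only: zero_le_mult_iff) simp
qed

section \<open>Garding cones and deletion of variables\<close>

definition esym_cone :: "'i set \<Rightarrow> nat \<Rightarrow> ('i \<Rightarrow> real) set" where
  "esym_cone A m = {x. \<forall>j\<in>{1..m}. esym A j x > 0}"

lemma esym_cone_pos: "finite A \<Longrightarrow> x \<in> esym_cone A m \<Longrightarrow> j \<le> m \<Longrightarrow> 0 < esym A j x"
  by (cases j) (auto simp: esym_cone_def esym_0)

lemma esym_cone_Suc: "x \<in> esym_cone A (Suc m) \<longleftrightarrow> x \<in> esym_cone A m \<and> 0 < esym A (Suc m) x"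
  by (auto simp: esym_cone_def le_Suc_eq)

text \<open>
  Let \<open>p, q, r\<close> be the polynomials of degrees \<open>m, m + 1, m + 2\<close> in the variables other than
  \<open>x\<^sub>i\<close>, with \<open>p > 0\<close> known inductively.  The combination
  \<open>p (r + x\<^sub>i q) - q (q + x\<^sub>i p) = p r - q\<^sup>2\<close> does not involve \<open>x\<^sub>i\<close>.  Both brackets are
  positive on the cone, so \<open>q \<le> 0\<close> would give \<open>p r > q\<^sup>2\<close> and contradict Newton's inequality.
\<close>

lemma esym_cone_remove:
  assumes "finite A" "i \<in> A"
  shows "x \<in> esym_cone A (Suc m) \<Longrightarrow> x \<in> esym_cone (A - {i}) m"
proof (induction m)
  case 0
  then show ?case by (simp add: esym_cone_def)
next
  case (Suc m)
  define p q r where "p = esym (A - {i}) m x" and "q = esym (A - {i}) (Suc m) x"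
    and "r = esym (A - {i}) (Suc (Suc m)) x"
  have mem: "x \<in> esym_cone (A - {i}) m"
    using Suc by (simp add: esym_cone_Suc)
  then have p: "0 < p" unfolding p_def using assms by (intro esym_cone_pos) auto
  have N: "p * r \<le> q\<^sup>2"
    unfolding p_def q_def r_def using assms by (intro esym_Newton) auto
  have e1: "0 < q + x i * p" and e2: "0 < r + x i * q"
    using Suc.prems esym_remove[OF assms, of _ x]
    by (auto simp: esym_cone_Suc p_def q_def r_def)
  have "0 < q"
  proof (rule ccontr)
    assume "\<not> 0 < q"
    then have "q * (q + x i * p) \<le> 0" using e1 by (simp add: mult_nonpos_nonneg)
    moreover have "0 < p * (r + x i * q)" using p e2 by simp
    ultimately show False using N by (simp add: power2_eq_square algebra_simps)
  qed
  then show ?case using mem by (simp add: esym_cone_Suc q_def)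
qed

section \<open>Superadditivity of consecutive ratios\<close>

text \<open>
  Rewrite \<open>a b / (a + b) = a - a\<^sup>2 / (a + b)\<close>.  The subtracted term decreases in \<open>b\<close>,
  whence the slack \<open>b + d \<le> s\<close>, and is subadditive because
  \<open>(a, u) \<mapsto> a\<^sup>2 / u\<close> is convex and homogeneous of degree one for \<open>u > 0\<close>.  Neither \<open>a\<close> nor \<open>b\<close>
  has to be positive separately.
\<close>

lemma parallel_sum_superadditive:
  fixes a b c d s :: real
  assumes ab: "0 < a + b" and cd: "0 < c + d" and s: "b + d \<le> s"
  shows "a * b / (a + b) + c * d / (c + d) \<le> (a + c) * s / (a + c + s)"
proof -
  have *: "u * v / (u + v) = u - u\<^sup>2 / (u + v)" if "0 < u + v" for u v :: real
    using that by (simp add: field_simps power2_eq_square)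
  have "(a + c)\<^sup>2 / ((a + c) + s) \<le> (a + c)\<^sup>2 / ((a + b) + (c + d))"
    using assms by (intro divide_left_mono mult_pos_pos) auto
  also have "\<dots> \<le> a\<^sup>2 / (a + b) + c\<^sup>2 / (c + d)"
  proof -
    define u v where "u = a + b" and "v = c + d"
    have uv: "0 < u" "0 < v" using ab cd by (auto simp: u_def v_def)
    have "a\<^sup>2 / u + c\<^sup>2 / v - (a + c)\<^sup>2 / (u + v) = (a * v - c * u)\<^sup>2 / (u * v * (u + v))"
      using uv by (simp add: field_simps power2_eq_square add_pos_pos)
    also have "\<dots> \<ge> 0" using uv by simp
    finally show ?thesis by (simp add: u_def v_def)
  qed
  finally have "(a + c)\<^sup>2 / ((a + c) + s) \<le> a\<^sup>2 / (a + b) + c\<^sup>2 / (c + d)" .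
  moreover have "0 < (a + c) + s" using assms by simp
  ultimately show ?thesis using *[OF ab] *[OF cd] *[of "a + c" s] by simp
qed

definition esym_ratio :: "'i set \<Rightarrow> nat \<Rightarrow> ('i \<Rightarrow> real) \<Rightarrow> real" where
  "esym_ratio A m x = esym A (Suc m) x / esym A m x"

text \<open>
  Dividing \<open>\<sigma>\<^sub>m\<^sub>+\<^sub>1(x) = \<sigma>\<^sub>m\<^sub>+\<^sub>1(x|i) + x\<^sub>i \<sigma>\<^sub>m(x|i)\<close> by \<open>\<sigma>\<^sub>m(x|i)\<close>, which is positive
  since deletion lowers the order of the cone by one only, gives \<open>x\<^sub>i + h\<^sub>i\<close>.  Hence each summand
  of Euler's relation becomes a parallel sum after division by \<open>\<sigma>\<^sub>m\<^sub>+\<^sub>1(x)\<close>.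
\<close>

lemma esym_ratio_Suc:
  assumes "finite A" "x \<in> esym_cone A (Suc m)"
  defines "h i \<equiv> esym_ratio (A - {i}) m x"
  shows "real (Suc (Suc m)) * esym_ratio A (Suc m) x = (\<Sum>i\<in>A. x i * h i / (x i + h i))"
    and "\<And>i. i \<in> A \<Longrightarrow> 0 < x i + h i"
proof -
  have d: "0 < esym (A - {i}) m x" if "i \<in> A" for i
    using esym_cone_remove[OF assms(1) that assms(2)] assms(1) by (intro esym_cone_pos) auto
  have e: "0 < esym A (Suc m) x" using assms by (simp add: esym_cone_Suc)
  have sum: "x i + h i = esym A (Suc m) x / esym (A - {i}) m x" if "i \<in> A" for i
    using d[OF that] by (simp add: h_def esym_ratio_def esym_remove[OF assms(1) that] field_simps)
  show "0 < x i + h i" if "i \<in> A" for i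
    using d[OF that] e by (simp add: sum[OF that])
  have "x i * h i / (x i + h i) = x i * esym (A - {i}) (Suc m) x / esym A (Suc m) x" if "i \<in> A" for i
    unfolding sum[OF that] using d[OF that] e by (simp add: h_def esym_ratio_def)
  then have "(\<Sum>i\<in>A. x i * h i / (x i + h i))
      = (\<Sum>i\<in>A. x i * esym (A - {i}) (Suc m) x) / esym A (Suc m) x"
    by (simp add: sum_divide_distrib)
  then show "real (Suc (Suc m)) * esym_ratio A (Suc m) x = (\<Sum>i\<in>A. x i * h i / (x i + h i))"
    by (simp add: esym_Euler[OF assms(1)] esym_ratio_def del: of_nat_Suc)
qed

text \<open>
  The two claims need each other: superadditivity of the ratio of order \<open>m\<close> makes
  \<open>\<sigma>\<^sub>m\<^sub>+\<^sub>1(x + y)\<close> positive, which puts \<open>x + y\<close> into the next cone, and only there do the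
  parallel sum formula and hence the next superadditivity make sense.
\<close>

lemma esym_cone_add_and_ratio_superadditive:
  assumes "finite A" "x \<in> esym_cone A m" "y \<in> esym_cone A m"
  shows "(\<lambda>i. x i + y i) \<in> esym_cone A m \<and>
    esym_ratio A m x + esym_ratio A m y \<le> esym_ratio A m (\<lambda>i. x i + y i)"
  using assms
proof (induction m arbitrary: A)
  case (0 A)
  have "esym A (Suc 0) z = (\<Sum>i\<in>A. z i)" for z
    using esym_Euler[OF 0(1), of z 0] 0(1) by (simp add: esym_0)
  then show ?case using 0 by (simp add: esym_cone_def esym_ratio_def esym_0 sum.distrib)
next
  case (Suc m A)
  let ?z = "\<lambda>i. x i + y i"
  have IH: "?z \<in> esym_cone A m" 
    "esym_ratio A m x + esym_ratio A m y \<le> esym_ratio A m ?z"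
    using Suc.IH[OF Suc.prems(1)] Suc.prems by (auto simp: esym_cone_Suc)
  have pos: "0 < esym A m v" if "v \<in> esym_cone A m" for v
    using Suc.prems(1) that by (intro esym_cone_pos) auto
  have "0 < esym_ratio A m x" "0 < esym_ratio A m y"
    using Suc.prems pos by (auto simp: esym_ratio_def esym_cone_Suc)
  then have "0 < esym_ratio A m ?z" using IH(2) by simp
  then have z: "?z \<in> esym_cone A (Suc m)"
    using IH(1) pos[OF IH(1)] by (simp add: esym_cone_Suc esym_ratio_def zero_less_divide_iff)
  let ?h = "\<lambda>v i. esym_ratio (A - {i}) m v"
  let ?g = "\<lambda>v i. v i * ?h v i / (v i + ?h v i)"
  have "?g x i + ?g y i \<le> ?g ?z i" if i: "i \<in> A" for i
  proof (rule parallel_sum_superadditive)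
    show "0 < x i + ?h x i" "0 < y i + ?h y i"
      using esym_ratio_Suc(2)[OF Suc.prems(1) _ i] Suc.prems by auto
    show "?h x i + ?h y i \<le> ?h ?z i"
      using Suc.IH[of "A - {i}"] Suc.prems esym_cone_remove[OF Suc.prems(1) i] by auto
  qed
  then have "(\<Sum>i\<in>A. ?g x i) + (\<Sum>i\<in>A. ?g y i) \<le> (\<Sum>i\<in>A. ?g ?z i)"
    by (simp add: sum_mono flip: sum.distrib)
  then have "real (Suc (Suc m)) * (esym_ratio A (Suc m) x + esym_ratio A (Suc m) y)
      \<le> real (Suc (Suc m)) * esym_ratio A (Suc m) ?z"
    by (simp only: distrib_left esym_ratio_Suc(1)[OF Suc.prems(1) Suc.prems(2)]
        esym_ratio_Suc(1)[OF Suc.prems(1) Suc.prems(3)] esym_ratio_Suc(1)[OF Suc.prems(1) z])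
  then have "esym_ratio A (Suc m) x + esym_ratio A (Suc m) y \<le> esym_ratio A (Suc m) ?z"
    by (simp only: mult_le_cancel_left_pos of_nat_0_less_iff zero_less_Suc)
  with z show ?case by blast
qed

section \<open>Roots of quotients as geometric means\<close>

text \<open>
  After division by the right-hand side, the two terms on the left are the geometric means of the
  numbers \<open>a\<^sub>j / (a\<^sub>j + b\<^sub>j)\<close> and \<open>b\<^sub>j / (a\<^sub>j + b\<^sub>j)\<close>.  They are bounded by the corresponding
  arithmetic means, which add up to \<open>1\<close>.
\<close>

lemma geometric_mean_superadditive:
  fixes a b :: "'j \<Rightarrow> real"
  assumes "finite J" "J \<noteq> {}" "\<And>j. j \<in> J \<Longrightarrow> 0 < a j" "\<And>j. j \<in> J \<Longrightarrow> 0 < b j"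
  defines "p \<equiv> 1 / real (card J)"
  shows "(\<Prod>j\<in>J. a j) powr p + (\<Prod>j\<in>J. b j) powr p \<le> (\<Prod>j\<in>J. a j + b j) powr p"
proof -
  have P: "0 < (\<Prod>j\<in>J. c j)" if "\<And>j. j \<in> J \<Longrightarrow> 0 < c j" for c :: "'j \<Rightarrow> real"
    using that by (intro prod_pos) auto
  have AG: "((\<Prod>j\<in>J. c j) / (\<Prod>j\<in>J. a j + b j)) powr p \<le> (\<Sum>j\<in>J. c j / (a j + b j)) / card J"
    if "\<And>j. j \<in> J \<Longrightarrow> 0 < c j" for c
  proof -
    have "0 \<le> c j / (a j + b j)" if "j \<in> J" for j
      using assms(3,4)[OF that] \<open>\<And>j. j \<in> J \<Longrightarrow> 0 < c j\<close>[OF that] by simp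
    then show ?thesis
      using arith_geom_mean[OF assms(1,2), of "\<lambda>j. c j / (a j + b j)"]
      by (simp only: prod_dividef p_def sum_divide_distrib)
  qed
  let ?Q = "\<Prod>j\<in>J. a j + b j"
  have Q: "0 < ?Q" using assms by (intro P add_pos_pos) auto
  have "((\<Prod>j\<in>J. a j) / ?Q) powr p + ((\<Prod>j\<in>J. b j) / ?Q) powr p
      \<le> (\<Sum>j\<in>J. a j / (a j + b j)) / card J + (\<Sum>j\<in>J. b j / (a j + b j)) / card J"
    using assms by (intro add_mono AG) auto
  also have "\<dots> = (\<Sum>j\<in>J. a j / (a j + b j) + b j / (a j + b j)) / card J"
    by (simp add: sum.distrib add_divide_distrib)
  also have "\<dots> = (\<Sum>j\<in>J. 1) / card J"
  proof -
    have "a j / (a j + b j) + b j / (a j + b j) = 1" if "j \<in> J" for j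
      using assms(3,4)[OF that] by (simp flip: add_divide_distrib)
    then show ?thesis by simp
  qed
  also have "\<dots> = 1" using assms(1,2) by simp
  finally have "((\<Prod>j\<in>J. a j) powr p + (\<Prod>j\<in>J. b j) powr p) / ?Q powr p \<le> 1"
    using P[of a] P[of b] Q assms by (simp add: powr_divide add_divide_distrib)
  then show ?thesis using Q by simp
qed

lemma prod_esym_ratio:
  assumes "finite A" "x \<in> esym_cone A k" "l \<le> k"
  shows "(\<Prod>j = l..<k. esym_ratio A j x) = esym A k x / esym A l x"
  using assms(3,2)
proof (induction k rule: dec_induct)
  case base
  then show ?case using esym_cone_pos[OF assms(1), of x l l] by simp
next
  case (step k)
  then show ?case using esym_cone_pos[OF assms(1), of x k k]
    by (simp add: esym_cone_Suc esym_ratio_def)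
qed

lemma esym_cone_antimono: "x \<in> esym_cone A k \<Longrightarrow> j \<le> k \<Longrightarrow> x \<in> esym_cone A j"
  by (auto simp: esym_cone_def)

lemma esym_ratio_pos: "finite A \<Longrightarrow> x \<in> esym_cone A k \<Longrightarrow> j < k \<Longrightarrow> 0 < esym_ratio A j x"
  by (simp add: esym_ratio_def esym_cone_pos[of A x k])

lemma esym_quotient_root_superadditive:
  assumes "finite A" "x \<in> esym_cone A k" "y \<in> esym_cone A k" "l < k"
  defines "F z \<equiv> (esym A k z / esym A l z) powr (1 / real (k - l))"
  shows "F x + F y \<le> F (\<lambda>i. x i + y i)"
proof -
  let ?z = "\<lambda>i. x i + y i"
  have z: "?z \<in> esym_cone A k"
    using esym_cone_add_and_ratio_superadditive[OF assms(1-3)] by simp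
  have F: "F v = (\<Prod>j = l..<k. esym_ratio A j v) powr (1 / real (card {l..<k}))"
    if "v \<in> esym_cone A k" for v
    using prod_esym_ratio[OF assms(1) that, of l] assms(4) by (simp add: F_def)
  have pos: "0 < esym_ratio A j v" if "v \<in> esym_cone A k" "j \<in> {l..<k}" for v j
    using esym_ratio_pos[OF assms(1) that(1)] that(2) by simp
  have "F x + F y \<le> (\<Prod>j = l..<k. esym_ratio A j x + esym_ratio A j y) powr (1 / real (card {l..<k}))"
    unfolding F[OF assms(2)] F[OF assms(3)]
    using assms pos by (intro geometric_mean_superadditive) auto
  also have "\<dots> \<le> F ?z"
    unfolding F[OF z]
  proof (intro powr_mono2 prod_mono prod_nonneg conjI)
    fix j assume j: "j \<in> {l..<k}"
    show "0 \<le> esym_ratio A j x + esym_ratio A j y"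
      using pos[OF _ j] assms by (simp add: add_nonneg_nonneg less_imp_le)
    then show "0 \<le> esym_ratio A j x + esym_ratio A j y" .
    show "esym_ratio A j x + esym_ratio A j y \<le> esym_ratio A j ?z"
      using esym_cone_add_and_ratio_superadditive[OF assms(1), of x j y]
        esym_cone_antimono[OF assms(2)] esym_cone_antimono[OF assms(3)] j by simp
  qed simp
  finally show ?thesis .
qed

lemma esym_scale: "esym A m (\<lambda>i. t * x i) = t ^ m * esym A m x"
  by (auto simp: esym_def prod.distrib sum_distrib_left intro!: sum.cong)

lemma esym_cone_scale: "0 < t \<Longrightarrow> x \<in> esym_cone A m \<Longrightarrow> (\<lambda>i. t * x i) \<in> esym_cone A m"
  by (auto simp: esym_cone_def esym_scale)

lemma esym_quotient_root_scale:
  assumes "finite A" "x \<in> esym_cone A k" "l < k" "0 < t"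
  defines "F z \<equiv> (esym A k z / esym A l z) powr (1 / real (k - l))"
  shows "F (\<lambda>i. t * x i) = t * F x"
proof -
  have "t ^ k / t ^ l = t powr real (k - l)"
    using assms(3,4) by (simp only: powr_realpow) (simp add: power_diff)
  then have "esym A k (\<lambda>i. t * x i) / esym A l (\<lambda>i. t * x i)
      = t powr real (k - l) * (esym A k x / esym A l x)"
    by (simp only: esym_scale flip: times_divide_times_eq)
  moreover have "0 < esym A k x / esym A l x"
    using assms by (simp add: esym_cone_pos[of A x k])
  ultimately have "F (\<lambda>i. t * x i) = (t powr real (k - l)) powr (1 / real (k - l)) * F x"
    unfolding F_def by (metis powr_mult)
  also have "(t powr real (k - l)) powr (1 / real (k - l)) = t"
    using assms(3,4) by (simp add: powr_powr del: of_nat_diff)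
  finally show ?thesis .
qed

section \<open>The parameter as an additional variable\<close>

definition extend :: "real \<Rightarrow> real ^ 'n \<Rightarrow> 'n option \<Rightarrow> real" where
  "extend \<alpha> x = case_option \<alpha> (\<lambda>i. x $ i)"

lemma extend_convex_combination:
  assumes "u + v = 1"
  shows "extend \<alpha> (u *\<^sub>R x + v *\<^sub>R y) = (\<lambda>i. u * extend \<alpha> x i + v * extend \<alpha> y i)"
proof
  fix i
  have "u * \<alpha> + v * \<alpha> = \<alpha>" using assms by (simp flip: distrib_right)
  then show "extend \<alpha> (u *\<^sub>R x + v *\<^sub>R y) i = u * extend \<alpha> x i + v * extend \<alpha> y i"
    by (cases i) (simp_all add: extend_def)
qed

lemma esym_reindex:
  assumes "inj_on g A"
  shows "esym (g ` A) m x = esym A m (x \<circ> g)"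
proof -
  have bij: "bij_betw (image g) {B. B \<subseteq> A \<and> card B = m} {B. B \<subseteq> g ` A \<and> card B = m}"
  proof (rule bij_betw_imageI)
    show "inj_on (image g) {B. B \<subseteq> A \<and> card B = m}"
      using assms by (auto simp: inj_on_def inj_on_image_eq_iff[OF assms])
    show "image g ` {B. B \<subseteq> A \<and> card B = m} = {B. B \<subseteq> g ` A \<and> card B = m}"
    proof (intro set_eqI iffI)
      fix B assume "B \<in> {B. B \<subseteq> g ` A \<and> card B = m}"
      then obtain C where "C \<subseteq> A" "B = g ` C" "card B = m" by (auto simp: subset_image_iff)
      then show "B \<in> image g ` {B. B \<subseteq> A \<and> card B = m}"
        using card_image[OF inj_on_subset[OF assms \<open>C \<subseteq> A\<close>]] by auto
    qed (auto simp: card_image inj_on_subset[OF assms])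
  qed
  show ?thesis
    unfolding esym_def
    by (subst sum.reindex_bij_betw[OF bij, symmetric])
      (auto intro!: sum.cong simp: prod.reindex inj_on_subset[OF assms])
qed

lemma esym_Some: "esym (range Some) m (extend \<alpha> x) = elem_sym m x"
  by (simp add: esym_reindex) (simp add: esym_def elem_sym_def extend_def comp_def)

lemma esym_extend_Suc:
  fixes x :: "real ^ 'n"
  shows "esym UNIV (Suc m) (extend \<alpha> x) = elem_sym (Suc m) x + \<alpha> * elem_sym m x"
proof -
  have "esym (insert None (range Some)) (Suc m) (extend \<alpha> x)
      = elem_sym (Suc m) x + extend \<alpha> x None * elem_sym m x"
    by (subst esym_insert) (auto simp: esym_Some)
  then show ?thesis by (simp add: UNIV_option_conv extend_def)
qed

lemma esym_cone_Some: "extend \<alpha> x \<in> esym_cone (range Some) m \<longleftrightarrow> x \<in> Garding_cone m"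
  by (simp add: esym_cone_def Garding_cone_def esym_Some)

text \<open>
  From left to right, \<open>\<sigma>\<^sub>j(x, \<alpha>) = \<sigma>\<^sub>j(x) + \<alpha> \<sigma>\<^sub>j\<^sub>-\<^sub>1(x)\<close> is positive for \<open>j \<le> k\<close> by \<open>\<alpha> \<ge> 0\<close>,
  and for \<open>j = k + 1\<close> by the second condition of the admissible set.  The converse deletes the
  variable \<open>\<alpha>\<close>.
\<close>

lemma sum_type_cone_eq_slice:
  fixes \<alpha> :: real
  assumes "0 \<le> \<alpha>"
  shows "(x :: real ^ 'n) \<in> sum_type_cone (Suc k) \<alpha> \<longleftrightarrow> extend \<alpha> x \<in> esym_cone UNIV (Suc k)"
proof
  assume x: "x \<in> sum_type_cone (Suc k) \<alpha>"
  have pos: "0 < elem_sym j x" if "j \<le> k" for j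
    using x that by (cases j) (auto simp: sum_type_cone_def Garding_cone_def elem_sym_0)
  have "0 < esym UNIV j (extend \<alpha> x)" if "1 \<le> j" "j \<le> Suc k" for j
  proof (cases "j = Suc k")
    case True
    then show ?thesis using x by (simp add: sum_type_cone_def esym_extend_Suc add.commute)
  next
    case False
    then obtain i where "j = Suc i" "Suc i \<le> k" using \<open>1 \<le> j\<close> \<open>j \<le> Suc k\<close> by (cases j) auto
    then show ?thesis using pos[of j] pos[of i] assms
      by (simp add: esym_extend_Suc add_pos_nonneg)
  qed
  then show "extend \<alpha> x \<in> esym_cone UNIV (Suc k)" by (simp add: esym_cone_def)
next
  assume e: "extend \<alpha> x \<in> esym_cone UNIV (Suc k)"
  then have "extend \<alpha> x \<in> esym_cone (UNIV - {None}) k"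
    by (intro esym_cone_remove) auto
  moreover have "UNIV - {None :: 'n option} = range Some"
    by (auto simp: UNIV_option_conv)
  ultimately have "x \<in> Garding_cone k"
    by (simp only: esym_cone_Some)
  then show "x \<in> sum_type_cone (Suc k) \<alpha>"
    using e by (simp add: sum_type_cone_def esym_cone_Suc esym_extend_Suc add.commute)
qed

text \<open>
  A convex combination of two points of the slice is the sum of two scaled points of the cone, to
  which superadditivity and homogeneity apply.
\<close>

lemma sum_type_quotient_concave:
  fixes \<alpha> :: real
  assumes "0 \<le> \<alpha>" "1 \<le> l" "l < k"
  shows "concave_on (sum_type_cone k \<alpha> :: (real ^ 'n) set)
    (\<lambda>x. (sum_type k \<alpha> x / sum_type l \<alpha> x) powr (1 / real (k - l)))"
proof -
  let ?C = "esym_cone UNIV k :: ('n option \<Rightarrow> real) set"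
  define F :: "('n option \<Rightarrow> real) \<Rightarrow> real"
    where "F z = (esym UNIV k z / esym UNIV l z) powr (1 / real (k - l))" for z
  have esym: "sum_type j \<alpha> x = esym UNIV j (extend \<alpha> x)" if "1 \<le> j" for j and x :: "real ^ 'n"
    using that by (cases j) (simp_all add: sum_type_def esym_extend_Suc)
  have slice: "x \<in> sum_type_cone k \<alpha> \<longleftrightarrow> extend \<alpha> x \<in> ?C" for x :: "real ^ 'n"
    using assms sum_type_cone_eq_slice[of \<alpha> x "k - 1"] by simp
  have comb: "extend \<alpha> (u *\<^sub>R x + v *\<^sub>R y) \<in> ?C \<and>
      u * F (extend \<alpha> x) + v * F (extend \<alpha> y) \<le> F (extend \<alpha> (u *\<^sub>R x + v *\<^sub>R y))"
    if xy: "extend \<alpha> x \<in> ?C" "extend \<alpha> y \<in> ?C" and uv: "0 \<le> u" "0 \<le> v" "u + v = 1"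
    for x y :: "real ^ 'n" and u v
  proof (cases "u = 0 \<or> v = 0")
    \<comment> \<open>Scaling by \<open>0\<close> leaves the open cone, so the end points are treated apart.\<close>
    case True
    then show ?thesis using xy uv by auto
  next
    case False
    then have pos: "0 < u" "0 < v" using uv by auto
    let ?x = "\<lambda>i. u * extend \<alpha> x i" and ?y = "\<lambda>i. v * extend \<alpha> y i"
    have mem: "?x \<in> ?C" "?y \<in> ?C" using pos xy by (simp_all add: esym_cone_scale)
    have "F ?x = u * F (extend \<alpha> x)" "F ?y = v * F (extend \<alpha> y)"
      unfolding F_def using pos xy assms(3) by (intro esym_quotient_root_scale; simp)+
    moreover have "F ?x + F ?y \<le> F (\<lambda>i. ?x i + ?y i)"
      unfolding F_def using mem assms by (intro esym_quotient_root_superadditive) auto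
    moreover have "(\<lambda>i. ?x i + ?y i) \<in> ?C"
      using esym_cone_add_and_ratio_superadditive[OF finite mem] by simp
    ultimately show ?thesis by (simp add: extend_convex_combination[OF uv(3)])
  qed
  have "(sum_type k \<alpha> x / sum_type l \<alpha> x) powr (1 / real (k - l)) = F (extend \<alpha> x)" for x :: "real ^ 'n"
    using assms by (simp add: F_def esym)
  then show ?thesis
    using comb by (simp add: concave_on_iff convex_def slice)
qed

theorem theorem2:
  fixes k :: nat and \<alpha> :: real
  assumes "1 \<le> k" and "k \<le> CARD('n::finite)" and "\<alpha> \<ge> 0"
  shows "\<exists>(S :: nat \<Rightarrow> real ^ 'n \<Rightarrow> real) (\<beta> :: nat \<Rightarrow> nat \<Rightarrow> real).
    (\<forall>l\<in>{1..k - 1}.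
       (\<forall>s<l. \<beta> l s \<ge> 0) \<and>
       (\<forall>x. S l x = elem_sym l x + (\<Sum>s<l. \<beta> l s * elem_sym s x))) \<and>
    (\<forall>l\<in>{1..k - 1}.
       concave_on (sum_type_cone k \<alpha>)
         (\<lambda>x. (sum_type k \<alpha> x / S l x) powr (1 / real (k - l))))"
proof (intro exI conjI ballI)
  \<comment> \<open>The polynomials are \<open>S l = sum_type l \<alpha>\<close>.\<close>
  let ?\<beta> = "\<lambda>l s. if s = l - 1 then \<alpha> else 0"
  fix l assume l: "l \<in> {1..k - 1}"
  show "\<forall>s<l. ?\<beta> l s \<ge> 0" using assms by simp
  have "(\<Sum>s<l. ?\<beta> l s * elem_sym s x) = \<alpha> * elem_sym (l - 1) x" for x :: "real ^ 'n"
  proof -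
    have "(\<Sum>s<l. ?\<beta> l s * elem_sym s x) = (\<Sum>s<l. if s = l - 1 then \<alpha> * elem_sym s x else 0)"
      by (intro sum.cong) auto
    then show ?thesis using l by (simp add: sum.delta)
  qed
  then show "\<forall>x :: real ^ 'n. sum_type l \<alpha> x = elem_sym l x + (\<Sum>s<l. ?\<beta> l s * elem_sym s x)"
    by (simp add: sum_type_def)
  show "concave_on (sum_type_cone k \<alpha> :: (real ^ 'n) set)
      (\<lambda>x. (sum_type k \<alpha> x / sum_type l \<alpha> x) powr (1 / real (k - l)))"
    using assms l by (intro sum_type_quotient_concave) auto
qed

end
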